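(* Let $p\ge1$ and $\sigma\in(\frac12,1)$ be fixed, and suppose $\kappa=(k_n)_{n\ge1}$ is a sequence of natural numbers that is Hartman uniformly distributed and $L^p$-good universal. Let $$R_N(\sigma,x,\kappa):=\frac1N\sum_{n=1}^{N}\zeta(\sigma+iT^{k_n}x)\qquad(N=1,2,\ldots).$$ Then $$\sum_{N\ge1}\bigl|R_{N+1}(\sigma,x,\kappa)-R_N(\sigma,x,\kappa)\bigr|=+\infty$$ for almost every $x\in\mathbb{R}$ with respect to Lebesgue measure.
   Context: $\zeta$ is the Riemann zeta function. $T:\mathbb{R}\to\mathbb{R}$ is the map $T(x)=\frac12\left(x-\frac1x\right)$ for $x\neq0$, $T(0)=0$, and $T^n$ is its $n$-th iterate; it preserves and is ergodic for the probability measure $\mu(A)=\frac1\pi\int_A\frac{dt}{1+t^2}$. A dynamical system $(X,\mathcal{A},\mu,T)$ is a probability space together with a measurable, measure preserving map. A sequence of natural numbers $(k_n)_{n\ge1}$ is $L^p$-good universal if for every dynamical system $(X,\mathcal{A},\mu,T)$ and every $g\in L^p(X,\mathcal{A},\mu)$ the limit $\lim_{N\to\infty}\frac1N\sum_{n=1}^{N}g(T^{k_n}x)$ exists for $\mu$-almost every $x$. A sequence of natural numbers $(k_n)_{n\ge1}$ is Hartman uniformly distributed if it is uniformly distributed among the residue classes modulo $m$ for each natural number $m>1$, and for each irrational number $\theta$ the sequence of fractional parts $(\{k_n\theta\})_{n\ge1}$ is uniformly distributed modulo one. *)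

theory Defs
  imports "HOL-Probability.Probability" "HOL-Complex_Analysis.Complex_Analysis"
begin

text \<open>
  The Riemann zeta function: the analytic continuation of the Dirichlet series to
  \<open>\<complex> - {1}\<close>. It is unique there by the identity theorem; the junk value at the pole makes
  it unique as a total function.
\<close>

definition zeta :: "complex \<Rightarrow> complex" where
  "zeta = (THE f. f holomorphic_on (- {1}) \<and>
                  (\<forall>s. Re s > 1 \<longrightarrow> (\<lambda>n. of_nat (Suc n) powr (- s)) sums f s) \<and>
                  f 1 = 0)"

definition boole_map :: "real \<Rightarrow> real" where
  "boole_map x = (if x = 0 then 0 else (x - 1 / x) / 2)"

definition dynamical_system :: "'a measure \<Rightarrow> ('a \<Rightarrow> 'a) \<Rightarrow> bool" where
  "dynamical_system M T \<longleftrightarrow>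
     prob_space M \<and> T \<in> measurable M M \<and>
     (\<forall>A\<in>sets M. emeasure M (T -` A \<inter> space M) = emeasure M A)"

definition Lp_function :: "real \<Rightarrow> 'a measure \<Rightarrow> ('a \<Rightarrow> complex) \<Rightarrow> bool" where
  "Lp_function p M g \<longleftrightarrow>
     g \<in> borel_measurable M \<and> integrable M (\<lambda>x. norm (g x) powr p)"

text \<open>
  Sequences are indexed from 1; the value \<open>k 0\<close> is never used.

  HOL cannot quantify over types inside a formula, so the type of the points of the
  underlying spaces is a parameter here. The spaces and sigma-algebras over that type are
  arbitrary. The type \<open>real\<close> already captures all dynamical systems over all types,
  see the lemma \<open>Lp_good_universal_real_imp\<close> below.
\<close>

definition Lp_good_universal :: "'a itself \<Rightarrow> real \<Rightarrow> (nat \<Rightarrow> nat) \<Rightarrow> bool" where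
  "Lp_good_universal _ p k \<longleftrightarrow>
     (\<forall>(M :: 'a measure) T g. dynamical_system M T \<longrightarrow> Lp_function p M g \<longrightarrow>
        (AE x in M. convergent (\<lambda>N. (\<Sum>n=1..N. g ((T ^^ k n) x)) / of_nat N)))"

definition uniformly_distributed_residues :: "nat \<Rightarrow> (nat \<Rightarrow> nat) \<Rightarrow> bool" where
  "uniformly_distributed_residues m k \<longleftrightarrow>
     (\<forall>r<m. (\<lambda>N. real (card {n\<in>{1..N}. k n mod m = r}) / real N) \<longlonglongrightarrow> 1 / real m)"

definition uniformly_distributed_mod_one :: "(nat \<Rightarrow> real) \<Rightarrow> bool" where
  "uniformly_distributed_mod_one u \<longleftrightarrow>
     (\<forall>a b. 0 \<le> a \<longrightarrow> a < b \<longrightarrow> b \<le> 1 \<longrightarrow>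
        (\<lambda>N. real (card {n\<in>{1..N}. frac (u n) \<in> {a..<b}}) / real N) \<longlonglongrightarrow> b - a)"

definition Hartman_uniformly_distributed :: "(nat \<Rightarrow> nat) \<Rightarrow> bool" where
  "Hartman_uniformly_distributed k \<longleftrightarrow>
     (\<forall>m>1. uniformly_distributed_residues m k) \<and>
     (\<forall>\<theta>. \<theta> \<notin> \<rat> \<longrightarrow> uniformly_distributed_mod_one (\<lambda>n. frac (real (k n) * \<theta>)))"

definition zeta_mean :: "(nat \<Rightarrow> nat) \<Rightarrow> real \<Rightarrow> real \<Rightarrow> nat \<Rightarrow> complex" where
  "zeta_mean k \<sigma> x N = (\<Sum>n=1..N. zeta (Complex \<sigma> ((boole_map ^^ k n) x))) / of_nat N"

lemma ex_inj_complex_seq_real: "\<exists>\<phi> :: (nat \<Rightarrow> complex) \<Rightarrow> real. inj \<phi>"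
proof -
  have r: "(UNIV :: real set) \<approx> (UNIV :: nat set set)"
    by (rule eqpoll_sym[OF nat_sets_eqpoll_reals])
  then obtain h :: "real \<Rightarrow> nat set" where h: "inj h"
    by (auto simp: eqpoll_def bij_betw_def)
  from eqpoll_sym[OF r] obtain h' :: "nat set \<Rightarrow> real" where h': "inj h'"
    by (auto simp: eqpoll_def bij_betw_def)
  define c :: "(nat \<Rightarrow> complex) \<Rightarrow> nat set" where
    "c z = {prod_encode (2 * n, i) | n i. i \<in> h (Re (z n))} \<union>
           {prod_encode (2 * n + 1, i) | n i. i \<in> h (Im (z n))}" for z
  have mem0: "prod_encode (2 * n, i) \<in> c z \<longleftrightarrow> i \<in> h (Re (z n))" for n i z
    unfolding c_def by (auto simp: prod_encode_eq) presburger
  have mem1: "prod_encode (2 * n + 1, i) \<in> c z \<longleftrightarrow> i \<in> h (Im (z n))" for n i z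
    unfolding c_def by (auto simp: prod_encode_eq) presburger
  have "inj c"
  proof (rule injI, rule ext)
    fix z w :: "nat \<Rightarrow> complex" and n
    assume eq: "c z = c w"
    have "h (Re (z n)) = h (Re (w n))" using mem0[of n _ z] mem0[of n _ w] eq by blast
    moreover have "h (Im (z n)) = h (Im (w n))" using mem1[of n _ z] mem1[of n _ w] eq by blast
    ultimately show "z n = w n" using h by (simp add: inj_eq complex_eq_iff)
  qed
  then show ?thesis using h' inj_compose by blast
qed

lemma Lp_good_universal_real_imp:
  assumes good: "Lp_good_universal TYPE(real) p k"
  shows "Lp_good_universal TYPE('a) p k"
  unfolding Lp_good_universal_def
proof (intro allI impI)
  fix M :: "'a measure" and T g
  assume ds: "dynamical_system M T" and Lp: "Lp_function p M g"
  interpret prob_space M using ds by (simp add: dynamical_system_def)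
  have T [measurable]: "T \<in> measurable M M" using ds by (simp add: dynamical_system_def)
  have g [measurable]: "g \<in> borel_measurable M" using Lp by (simp add: Lp_function_def)
  obtain \<phi> :: "(nat \<Rightarrow> complex) \<Rightarrow> real" where \<phi>: "inj \<phi>" using ex_inj_complex_seq_real by blast
  define \<psi> where "\<psi> = inv \<phi>"
  have \<psi>\<phi> [simp]: "\<psi> (\<phi> z) = z" for z using \<phi> by (simp add: \<psi>_def)
  define P :: "(nat \<Rightarrow> complex) measure" where "P = Pi\<^sub>M UNIV (\<lambda>_. borel)"
  have space_P [simp]: "space P = UNIV" by (simp add: P_def space_PiM)
  have comp: "(\<lambda>z. z n) \<in> borel_measurable P" for n
    unfolding P_def by (rule measurable_component_singleton) simp
  define V where "V = vimage_algebra UNIV \<psi> P"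
  have \<psi>: "\<psi> \<in> measurable V P" unfolding V_def by (rule measurable_vimage_algebra1) simp
  have into_V: "f \<in> measurable L V" if "(\<lambda>x. \<psi> (f x)) \<in> measurable L P" for f and L :: "'c measure"
    unfolding V_def by (rule measurable_vimage_algebra2) (use that in auto)
  have into_P: "f \<in> measurable L P" if "\<And>n. (\<lambda>x. f x n) \<in> borel_measurable L"
    for f and L :: "'c measure"
    unfolding P_def by (rule measurable_PiM_single') (use that in auto)
  define \<pi> where "\<pi> x = \<phi> (\<lambda>n. g ((T ^^ n) x))" for x
  define T' where "T' y = \<phi> (\<lambda>n. \<psi> y (Suc n))" for y
  define g' where "g' y = \<psi> y 0" for y
  have \<pi>: "\<pi> \<in> measurable M V"
    unfolding \<pi>_def by (intro into_V) (simp, intro into_P, measurable)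
  define N where "N = distr M V \<pi>"
  have sets_N [simp]: "sets N = sets V" by (simp add: N_def)
  have spV: "space V = UNIV" by (simp add: V_def)
  have comp': "(\<lambda>y. \<psi> y n) \<in> borel_measurable V" for n
    using measurable_compose[OF \<psi> comp] .
  have T': "T' \<in> measurable V V"
    unfolding T'_def by (intro into_V) (simp, intro into_P comp')
  have g': "g' \<in> borel_measurable V" unfolding g'_def by (rule comp')
  have T'\<pi>: "T' (\<pi> x) = \<pi> (T x)" for x
    by (simp add: T'_def \<pi>_def funpow_swap1)
  have pow: "(T' ^^ n) (\<pi> x) = \<pi> ((T ^^ n) x)" for n x
    by (induction n) (simp_all add: T'\<pi>)
  have g'\<pi>: "g' (\<pi> x) = g x" for x by (simp add: g'_def \<pi>_def)
  have "dynamical_system N T'"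
    unfolding dynamical_system_def
  proof (intro conjI ballI)
    show "prob_space N" unfolding N_def by (rule prob_space_distr[OF \<pi>])
    show "T' \<in> measurable N N" using T' by (simp add: N_def)
    fix A assume "A \<in> sets N"
    then have A: "A \<in> sets V" by simp
    have TA: "T' -` A \<in> sets V" using measurable_sets[OF T' A] by (simp add: spV)
    have pA: "\<pi> -` A \<inter> space M \<in> sets M" using measurable_sets[OF \<pi> A] .
    have "emeasure N (T' -` A \<inter> space N) = emeasure M (\<pi> -` (T' -` A) \<inter> space M)"
      by (simp add: N_def spV emeasure_distr[OF \<pi> TA])
    also have "\<pi> -` (T' -` A) \<inter> space M = T -` (\<pi> -` A \<inter> space M) \<inter> space M"
      using measurable_space[OF T] by (auto simp: T'\<pi>)
    also have "emeasure M \<dots> = emeasure M (\<pi> -` A \<inter> space M)"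
      using ds pA unfolding dynamical_system_def by blast
    also have "\<dots> = emeasure N A" by (simp add: N_def emeasure_distr[OF \<pi> A])
    finally show "emeasure N (T' -` A \<inter> space N) = emeasure N A" .
  qed
  moreover have "Lp_function p N g'"
  proof -
    have "(\<lambda>y. norm (g' y) powr p) \<in> borel_measurable V" using g' by measurable
    then show ?thesis
      using g' Lp by (simp add: Lp_function_def N_def integrable_distr_eq[OF \<pi>] g'\<pi>)
  qed
  ultimately have "AE y in N. convergent (\<lambda>N. (\<Sum>n=1..N. g' ((T' ^^ k n) y)) / of_nat N)"
    using good unfolding Lp_good_universal_def by blast
  from AE_distrD[OF \<pi> this[unfolded N_def]]
  show "AE x in M. convergent (\<lambda>N. (\<Sum>n=1..N. g ((T ^^ k n) x)) / of_nat N)"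
    by (simp add: pow g'\<pi>)
qed

end

theory Submission
  imports Defs
begin

text \<open>
  Bounded variation of the means forces them to converge to some \<open>L\<close>, and then the orbit
  visits the set where \<open>\<zeta>(\<sigma> + i\<cdot>)\<close> stays away from \<open>L\<close> only at times \<open>n\<close> with
  \<open>\<Sum> 1/n < \<infinity>\<close>. If \<open>\<zeta>\<close> takes values near two distinct points on open sets \<open>U\<^sub>1\<close> and \<open>U\<^sub>2\<close>,
  one of these sets is visited that rarely. On the other hand, \<open>x = cot (\<pi>\<theta>)\<close>
  conjugates the map to the doubling map, for which visits to a dyadic interval at times
  \<open>k\<^sub>i, k\<^sub>j\<close> far apart are independent; uniform distribution in residue classes makes
  close pairs negligible, and a second moment bound shows that rare visits happen only on a null set.

  Since \<open>zeta\<close> is defined by its characterization, its analytic continuation has to be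
  constructed: the binomial expansion of \<open>(1 + 1/n)\<^bsup>1 - s\<^esup>\<close> in
  \<open>\<Sum> ((n + 1)\<^bsup>1 - s\<^esup> - n\<^bsup>1 - s\<^esup>)\<close> expresses \<open>(s - 1) \<zeta>(s)\<close> by values of \<open>\<zeta>\<close> further to
  the right, which extends it one vertical strip at a time.
\<close>

subsection \<open>Analytic continuation of the zeta function\<close>

text \<open>Each factor \<open>a - i\<close> has norm at most \<open>B + i\<close>. The bound is, up
  to sign, the binomial coefficient of exponent \<open>-B\<close>, so it comes with a closed-form
  majorant series.\<close>

lemma gbinomial_norm_le:
  fixes a :: complex
  assumes "norm a \<le> B"
  shows "norm (a gchoose j) \<le> pochhammer B j / fact j"
proof -
  have "norm (\<Prod>i=0..<j. a - of_nat i) = (\<Prod>i=0..<j. norm (a - of_nat i))"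
    by (simp add: prod_norm)
  also have "\<dots> \<le> (\<Prod>i=0..<j. B + of_nat i)"
  proof (rule prod_mono, safe)
    fix i
    show "norm (a - of_nat i) \<le> B + of_nat i"
      using norm_triangle_ineq4[of a "of_nat i"] assms by simp
  qed simp
  finally show ?thesis
    by (simp add: gbinomial_prod_rev norm_divide pochhammer_prod divide_right_mono)
qed

text \<open>The binomial series of (1 - x) to the power -B at x = 1/2, the majorant for the
  remainder estimate below.\<close>

lemma pochhammer_series_sums:
  "(\<lambda>j. pochhammer B j / fact j * (1/2) ^ j) sums (2 powr B)" for B :: real
proof -
  have "(\<lambda>j. ((-B) gchoose j) * (-1/2)^j) sums (1 + (-1/2)) powr (-B)"
    by (rule gen_binomial_real) simp
  moreover have "((-B) gchoose j) * (-1/2)^j = pochhammer B j / fact j * (1/2) ^ j" for j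
  proof -
    have "(- 1) ^ j * (-1/2) ^ j = (1/2 :: real) ^ j" by (simp flip: power_mult_distrib)
    then show ?thesis by (simp add: gbinomial_pochhammer field_simps)
  qed
  ultimately show ?thesis by (simp add: powr_minus powr_divide)
qed

definition binomial_remainder :: "nat \<Rightarrow> complex \<Rightarrow> complex \<Rightarrow> complex" where
  "binomial_remainder J a w = (1 + w) powr a - (\<Sum>j\<le>J. (a gchoose j) * w ^ j)"

text \<open>With u = 2|w| at most 1, |w|^K = u^K (1/2)^K is at most u^(J+1) (1/2)^K for every K
  beyond J. Pulling out u^(J+1) leaves part of the majorant series, whose full sum is
  \<open>2 powr B\<close>.\<close>

lemma binomial_remainder_bound:
  assumes "norm a \<le> B" "norm w \<le> 1/2"
  shows "norm (binomial_remainder J a w) \<le> (2 * norm w) ^ Suc J * 2 powr B"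
proof -
  define f where "f j = (a gchoose j) * w ^ j" for j
  define g where "g j = (2 * norm w) ^ Suc J * (pochhammer B j / fact j * (1/2) ^ j)" for j
  have B: "0 \<le> B" using assms(1) norm_ge_zero order_trans by blast
  have g0: "0 \<le> pochhammer B j / fact j * (1/2) ^ j" for j
    using B by (auto simp: pochhammer_prod intro!: divide_nonneg_nonneg mult_nonneg_nonneg prod_nonneg)
  have f: "f sums (1 + w) powr a"
    unfolding f_def using assms by (intro gen_binomial_complex) simp
  have g: "g sums ((2 * norm w) ^ Suc J * 2 powr B)"
    unfolding g_def by (intro sums_mult pochhammer_series_sums)
  have "binomial_remainder J a w = (\<Sum>j. f (j + Suc J))"
    unfolding suminf_minus_initial_segment[OF sums_summable[OF f]] sums_unique[OF f, symmetric]
    by (simp add: binomial_remainder_def f_def lessThan_Suc_atMost)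
  also have "norm \<dots> \<le> (\<Sum>j. g (j + Suc J))"
  proof (rule norm_suminf_le)
    show "summable (\<lambda>j. g (j + Suc J))"
      by (rule summable_ignore_initial_segment[OF sums_summable[OF g]])
    fix j
    define K where "K = j + Suc J"
    define u where "u = 2 * norm w"
    have u: "0 \<le> u" "u \<le> 1" using assms by (auto simp: u_def)
    have "norm w ^ K = (u * (1/2)) ^ K" by (simp add: u_def)
    also have "\<dots> = u ^ K * (1/2) ^ K" by (rule power_mult_distrib)
    also have "\<dots> \<le> u ^ Suc J * (1/2) ^ K"
      using u by (intro mult_right_mono power_decreasing) (auto simp: K_def)
    finally have "norm (a gchoose K) * norm w ^ K \<le> pochhammer B K / fact K * (u ^ Suc J * (1/2) ^ K)"
      using assms(1) order_trans[OF norm_ge_zero gbinomial_norm_le[OF assms(1)]]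
      by (intro mult_mono gbinomial_norm_le) auto
    also have "\<dots> = g K" unfolding g_def u_def by (rule mult.left_commute)
    finally show "norm (f (j + Suc J)) \<le> g (j + Suc J)"
      unfolding f_def norm_mult norm_power K_def .
  qed
  also have "\<dots> \<le> (\<Sum>j. g j)"
  proof -
    have "0 \<le> (\<Sum>j<Suc J. g j)" unfolding g_def by (intro sum_nonneg mult_nonneg_nonneg g0) auto
    then show ?thesis using suminf_split_initial_segment[OF sums_summable[OF g], of "Suc J"] by simp
  qed
  finally show ?thesis using sums_unique[OF g] by simp
qed

text \<open>Every further term of the expansion gains one power of n, so these terms are summable
  over n for Re s > 1 - J. The constant depends on s only through the bound \<open>B\<close>, which
  gives locally uniform convergence.\<close>

lemma binomial_remainder_nat_bound:
  assumes "norm s \<le> B" "2 \<le> n"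
  shows "norm (of_nat n powr (1 - s) * binomial_remainder J (1 - s) (inverse (of_nat n)))
         \<le> 2 ^ Suc J * 2 powr (1 + B) * real n powr (- Re s - real J)"
proof -
  have "norm (1 - s) \<le> 1 + B" using norm_triangle_ineq4[of 1 s] assms by simp
  then have "norm (binomial_remainder J (1 - s) (inverse (of_nat n))) \<le> (2 * norm (inverse (of_nat n) :: complex)) ^ Suc J * 2 powr (1 + B)"
    using assms(2) by (intro binomial_remainder_bound) (auto simp: norm_inverse norm_divide field_simps)
  also have "\<dots> = 2 ^ Suc J * 2 powr (1 + B) * real n powr (- real (Suc J))"
    using assms(2) unfolding power_mult_distrib powr_minus
    by (subst powr_realpow) (auto simp: norm_inverse power_inverse)
  finally have "norm (of_nat n powr (1 - s) * binomial_remainder J (1 - s) (inverse (of_nat n)))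
      \<le> real n powr (1 - Re s) * (2 ^ Suc J * 2 powr (1 + B) * real n powr (- real (Suc J)))"
    using assms(2) by (simp add: norm_mult norm_powr_real_powr mult_left_mono)
  also have "\<dots> = 2 ^ Suc J * 2 powr (1 + B) * (real n powr ((1 - Re s) + (- real (Suc J))))"
    by (simp only: powr_add mult_ac)
  also have "(1 - Re s) + (- real (Suc J)) = - Re s - real J" by simp
  finally show ?thesis .
qed

section \<open>Series of holomorphic functions on a right half-plane\<close>

lemma holomorphic_suminf:
  fixes f :: "nat \<Rightarrow> complex \<Rightarrow> complex"
  assumes "\<And>n. f n holomorphic_on {s. c < Re s}"
    and bd: "\<And>B. \<exists>C. \<forall>n s. c < Re s \<longrightarrow> norm s \<le> B \<longrightarrow> norm (f n s) \<le> C * real (n + 2) powr (c - 1 - Re s)"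
  shows "(\<lambda>s. \<Sum>n. f n s) holomorphic_on {s. c < Re s}"
    and "\<And>s. c < Re s \<Longrightarrow> summable (\<lambda>n. f n s)"
proof -
  let ?S = "{s. c < Re s}"
  have op: "open ?S" by (rule open_halfspace_Re_gt)
  obtain g where g: "\<forall>x\<in>?S. (\<lambda>n. f n x) sums g x \<and> g field_differentiable (at x)"
  proof (rule series_differentiable_comparison_complex[OF op, of f])
    show "f n field_differentiable at x" if "x \<in> ?S" for n x
      using assms(1)[of n] op that holomorphic_on_imp_differentiable_at by blast
    fix z assume z: "z \<in> ?S"
    \<comment> \<open>Half the distance to the boundary line: on the ball of radius r around z, Re y
      stays at least c + r, so the exponent is at most -1 - r and the comparison series
      converges.\<close>
    define r where "r = (Re z - c) / 2"
    have r: "r > 0" using z by (simp add: r_def)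
    obtain C where C: "\<And>n s. c < Re s \<Longrightarrow> norm s \<le> norm z + r \<Longrightarrow> norm (f n s) \<le> C * real (n + 2) powr (c - 1 - Re s)"
      using bd[of "norm z + r"] by blast
    define h where "h n = complex_of_real (\<bar>C\<bar> * real (n + 2) powr (- 1 - r))" for n
    show "\<exists>d h. 0 < d \<and> summable h \<and> range h \<subseteq> \<real>\<^sub>\<ge>\<^sub>0 \<and> (\<forall>\<^sub>F n in sequentially. \<forall>y\<in>ball z d \<inter> ?S. cmod (f n y) \<le> cmod (h n))"
    proof (intro exI conjI always_eventually allI ballI)
      show "0 < r" by fact
      have "summable (\<lambda>n. real n powr (- 1 - r))" using r by (simp add: summable_real_powr_iff)
      then have "summable (\<lambda>n. real (n + 2) powr (- 1 - r))" by (subst summable_iff_shift) 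
      then show "summable h" unfolding h_def by (intro summable_of_real summable_mult)
      show "range h \<subseteq> \<real>\<^sub>\<ge>\<^sub>0" by (auto simp: h_def)
      fix n y assume y: "y \<in> ball z r \<inter> ?S"
      have "norm (y - z) < r" using y by (simp add: dist_norm norm_minus_commute)
      then have "norm y \<le> norm z + r" and re: "Re y \<ge> c + r"
        using norm_triangle_ineq2[of y z] abs_Re_le_cmod[of "y - z"] by (auto simp: r_def field_simps)
      then have "norm (f n y) \<le> C * real (n + 2) powr (c - 1 - Re y)" using C y by simp
      also have "\<dots> \<le> \<bar>C\<bar> * real (n + 2) powr (- 1 - r)"
        using re by (intro mult_mono powr_mono) auto
      finally show "norm (f n y) \<le> norm (h n)" by (simp add: h_def norm_mult)
    qed
  qed
  show "(\<lambda>s. \<Sum>n. f n s) holomorphic_on ?S"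
  proof (rule holomorphic_transform)
    show "g holomorphic_on ?S" using g op by (auto simp: holomorphic_on_def field_differentiable_at_within)
  qed (use g in \<open>auto dest!: bspec simp: sums_unique\<close>)
  show "summable (\<lambda>n. f n s)" if "c < Re s" for s using g that by (auto simp: summable_def)
qed

section \<open>Continuation by one vertical strip at a time\<close>

text \<open>The last factor of the larger binomial coefficient is \<open>- (s + of_nat i)\<close>,
  which cancels the denominator. Hence the shifted zeta values in the recurrence cause no poles at
  nonpositive integers.\<close>

lemma gbinomial_over_shift:
  fixes s :: complex
  assumes "s + of_nat i \<noteq> 0"
  shows "((1 - s) gchoose (i + 2)) / (s + of_nat i) = - ((1 - s) gchoose (i + 1)) / of_nat (i + 2)"
proof -
  have "of_nat (i + 2) * ((1 - s) gchoose (i + 2)) = (1 - s - of_nat (i + 1)) * ((1 - s) gchoose (i + 1))"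
    using gbinomial_mult_1[of "1 - s" "i + 1"] by (simp add: algebra_simps eq_neg_iff_add_eq_0)
  moreover have "1 - s - of_nat (i + 1) = - (s + of_nat i)" by simp
  ultimately have "of_nat (i + 2) * ((1 - s) gchoose (i + 2)) = - (s + of_nat i) * ((1 - s) gchoose (i + 1))"
    by metis
  moreover have "(of_nat (i + 2) :: complex) \<noteq> 0" unfolding of_nat_eq_0_iff by simp
  ultimately show ?thesis
    by (subst frac_eq_eq[OF assms]) (assumption, metis mult.commute mult_minus_left)
qed

text \<open>The Dirichlet series without its first term. Starting at 2 keeps 1/n in the disc of
  radius 1/2 on which the remainder is estimated.\<close>

definition zeta_tail :: "complex \<Rightarrow> complex" where
  "zeta_tail s = (\<Sum>n. of_nat (n + 2) powr (- s))"

lemma zeta_tail_holomorphic: "zeta_tail holomorphic_on {s. 1 < Re s}"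
  and zeta_tail_summable: "1 < Re s \<Longrightarrow> summable (\<lambda>n. of_nat (n + 2) powr (- s))"
proof -
  have 1: "(\<lambda>s. of_nat (n + 2) powr (- s)) holomorphic_on {s. 1 < Re s}" for n
    by (intro holomorphic_intros)
  have 2: "\<exists>C. \<forall>n s. 1 < Re s \<longrightarrow> norm s \<le> B \<longrightarrow>
      norm (of_nat (n + 2) powr (- s)) \<le> C * real (n + 2) powr (1 - 1 - Re s)" for B
    by (intro exI[of _ 1]) (simp add: norm_powr_real_powr del: of_nat_add)
  show "zeta_tail holomorphic_on {s. 1 < Re s}"
    using holomorphic_suminf(1)[of "\<lambda>n s. of_nat (n + 2) powr (- s)" 1] 1 2
    unfolding zeta_tail_def by blast
  show "1 < Re s \<Longrightarrow> summable (\<lambda>n. of_nat (n + 2) powr (- s))"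
    using holomorphic_suminf(2)[of "\<lambda>n s. of_nat (n + 2) powr (- s)" 1] 1 2 by blast
qed

text \<open>Write (n+1)^(1-s) as n^(1-s) (1 + 1/n)^(1-s), expand binomially and sum over n from 2
  on. The differences telescope to \<open>- (2 powr (1 - s))\<close>, the linear term gives
  \<open>(1 - s) * zeta_tail s\<close>, and the term of degree i + 2 gives the value at s + i +
  1.\<close>

lemma zeta_tail_recurrence:
  assumes s: "1 < Re s"
  shows "(s - 1) * zeta_tail s = 2 powr (1 - s)
    + (\<Sum>i<m. ((1 - s) gchoose (i + 2)) * zeta_tail (s + of_nat (i + 1)))
    + (\<Sum>n. of_nat (n + 2) powr (1 - s) * binomial_remainder (m + 1) (1 - s) (inverse (of_nat (n + 2))))"
    (is "_ = _ + ?S + suminf ?\<rho>")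
proof -
  have term_eq: "of_nat (n + 3) powr (1 - s) - of_nat (n + 2) powr (1 - s)
      = (1 - s) * of_nat (n + 2) powr (- s)
      + (\<Sum>i<m. ((1 - s) gchoose (i + 2)) * of_nat (n + 2) powr (- (s + of_nat (i + 1)))) + ?\<rho> n" for n
  proof -
    define x where "x = (of_nat (n + 2) :: complex)"
    have x: "x \<noteq> 0" unfolding x_def of_nat_eq_0_iff by simp
    have xr: "x = of_real (real (n + 2))" by (simp add: x_def)
    have pw: "x powr (1 - s) * inverse x ^ j = x powr (1 - s - of_nat j)" for j
      using x by (simp add: powr_diff powr_nat power_inverse divide_inverse del: of_nat_add)
    have "x powr (1 - s) * (1 + inverse x) powr (1 - s) = (x * (1 + inverse x)) powr (1 - s)"
      using powr_times_real[of x "1 + inverse x" "1 - s"] 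
      by (simp add: x_def add_nonneg_nonneg)
    also have "x * (1 + inverse x) = of_nat (n + 3)" using x by (simp add: distrib_left) (simp add: x_def)
    finally have "x powr (1 - s) * binomial_remainder (m + 1) (1 - s) (inverse x)
        = of_nat (n + 3) powr (1 - s) - (\<Sum>j\<le>m + 1. ((1 - s) gchoose j) * x powr (1 - s - of_nat j))"
      by (simp add: binomial_remainder_def right_diff_distrib sum_distrib_left mult.left_commute pw
           del: sum.atMost_Suc)
    also have "(\<Sum>j\<le>m + 1. ((1 - s) gchoose j) * x powr (1 - s - of_nat j))
        = x powr (1 - s) + (1 - s) * x powr (- s) + (\<Sum>i<m. ((1 - s) gchoose (i + 2)) * x powr (- (s + of_nat (i + 1))))"
    proof -
      have split: "(\<Sum>j\<le>m + 1. F j) = F 0 + F 1 + (\<Sum>i<m. F (i + 2))" for F :: "nat \<Rightarrow> complex"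
        by (simp add: sum.lessThan_Suc_shift flip: lessThan_Suc_atMost del: sum.lessThan_Suc)
      have e: "1 - s - of_nat (i + 2) = - (s + of_nat (i + 1))" for i by simp
      show ?thesis unfolding split e by simp
    qed
    finally show ?thesis by (simp add: x_def)
  qed
  have Re1: "1 < Re (s + of_nat (i + 1))" for i using s by simp
  have pow0: "(\<lambda>n. of_nat (n + 2) powr (1 - s) :: complex) \<longlonglongrightarrow> 0"
  proof (rule Lim_null_comparison)
    have "(\<lambda>n. real n powr (1 - Re s)) \<longlonglongrightarrow> 0" using s by real_asymp
    then show "(\<lambda>n. real (n + 2) powr (1 - Re s)) \<longlonglongrightarrow> 0" by (rule LIMSEQ_ignore_initial_segment)
    show "\<forall>\<^sub>F n in sequentially. norm (of_nat (n + 2) powr (1 - s) :: complex) \<le> real (n + 2) powr (1 - Re s)"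
      by (simp add: norm_powr_real_powr del: of_nat_add)
  qed
  have A: "(\<lambda>n. of_nat (Suc n + 2) powr (1 - s) - of_nat (n + 2) powr (1 - s)) sums (0 - of_nat (0 + 2) powr (1 - s))"
    by (rule telescope_sums[OF pow0])
  have B: "(\<lambda>n. (1 - s) * of_nat (n + 2) powr (- s)) sums ((1 - s) * zeta_tail s)"
    unfolding zeta_tail_def by (intro sums_mult summable_sums zeta_tail_summable s)
  have C: "(\<lambda>n. \<Sum>i<m. ((1 - s) gchoose (i + 2)) * of_nat (n + 2) powr (- (s + of_nat (i + 1)))) sums ?S"
    unfolding zeta_tail_def by (intro sums_sum sums_mult summable_sums zeta_tail_summable Re1)
  have "(\<lambda>n. of_nat (Suc n + 2) powr (1 - s) - of_nat (n + 2) powr (1 - s)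
      - (1 - s) * of_nat (n + 2) powr (- s)
      - (\<Sum>i<m. ((1 - s) gchoose (i + 2)) * of_nat (n + 2) powr (- (s + of_nat (i + 1)))))
      sums (0 - of_nat (0 + 2) powr (1 - s) - (1 - s) * zeta_tail s - ?S)"
    by (rule sums_diff[OF sums_diff[OF A B] C])
  also have "(\<lambda>n. of_nat (Suc n + 2) powr (1 - s) - of_nat (n + 2) powr (1 - s)
      - (1 - s) * of_nat (n + 2) powr (- s)
      - (\<Sum>i<m. ((1 - s) gchoose (i + 2)) * of_nat (n + 2) powr (- (s + of_nat (i + 1))))) = ?\<rho>"
  proof
    fix n
    have "Suc n + 2 = n + 3" by simp
    then show "of_nat (Suc n + 2) powr (1 - s) - of_nat (n + 2) powr (1 - s)
      - (1 - s) * of_nat (n + 2) powr (- s)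
      - (\<Sum>i<m. ((1 - s) gchoose (i + 2)) * of_nat (n + 2) powr (- (s + of_nat (i + 1)))) = ?\<rho> n"
      using term_eq[of n] by (simp only: ) (simp only: diff_diff_add add_diff_cancel_left')
  qed
  finally show ?thesis by (simp add: sums_iff algebra_simps)
qed

text \<open>On the right of the recurrence, \<open>zeta_tail\<close> occurs only at arguments
  shifted by at least 1, where the previous continuation is available, and the remainder series
  converges for Re s > -m. So each induction step extends the half-plane by one unit.\<close>

lemma zeta_tail_strip:
  "\<exists>Z. Z holomorphic_on {s. 1 - real m < Re s} \<and> (\<forall>s. 1 < Re s \<longrightarrow> Z s = (s - 1) * zeta_tail s)"
proof (induction m)
  case 0
  show ?case
    by (intro exI[of _ "\<lambda>s. (s - 1) * zeta_tail s"]) (auto intro!: holomorphic_intros zeta_tail_holomorphic)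
next
  case (Suc m)
  then obtain Z where Z: "Z holomorphic_on {s. 1 - real m < Re s}"
    and Zt: "\<And>s. 1 < Re s \<Longrightarrow> Z s = (s - 1) * zeta_tail s" by blast
  let ?S = "{s. 1 - real (Suc m) < Re s}"
  define \<rho> where "\<rho> n s = of_nat (n + 2) powr (1 - s)
      * binomial_remainder (m + 1) (1 - s) (inverse (of_nat (n + 2)))" for n s
  \<comment> \<open>The right side of the recurrence with
    \<open>zeta_tail (s + of_nat (i + 1))\<close> replaced by
    \<open>Z (s + of_nat (i + 1)) / (s + of_nat i)\<close>, the quotient being absorbed by
    \<open>gbinomial_over_shift\<close>.\<close>
  define Z' where "Z' s = 2 powr (1 - s)
    - (\<Sum>i<m. ((1 - s) gchoose (i + 1)) / of_nat (i + 2) * Z (s + of_nat (i + 1))) + (\<Sum>n. \<rho> n s)" for s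
  have gch: "(\<lambda>s. (1 - s) gchoose j) holomorphic_on A" for j and A :: "complex set"
    unfolding gbinomial_prod_rev by (intro holomorphic_intros) auto
  have "(\<lambda>s. \<Sum>n. \<rho> n s) holomorphic_on {s. - real m < Re s}"
  proof (rule holomorphic_suminf(1))
    fix n
    have "1 + inverse (of_nat (n + 2)) = complex_of_real (1 + inverse (real (n + 2)))" by simp
    also have "\<dots> \<noteq> 0" unfolding of_real_eq_0_iff by (rule less_imp_neq[symmetric]) (simp add: add_pos_pos)
    finally have nz: "1 + inverse (of_nat (n + 2)) \<noteq> (0 :: complex)" .
    show "\<rho> n holomorphic_on {s. - real m < Re s}"
      unfolding \<rho>_def binomial_remainder_def
      by (intro holomorphic_intros gch)
  next
    fix B
    show "\<exists>C. \<forall>n s. - real m < Re s \<longrightarrow> norm s \<le> B \<longrightarrow>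
        norm (\<rho> n s) \<le> C * real (n + 2) powr (- real m - 1 - Re s)"
    proof (intro exI allI impI)
      fix n and s :: complex assume "norm s \<le> B"
      have e: "- real m - 1 - Re s = - Re s - real (m + 1)" by simp
      from binomial_remainder_nat_bound[OF \<open>norm s \<le> B\<close>, of "n + 2" "m + 1"]
      show "norm (\<rho> n s) \<le> (2 ^ Suc (m + 1) * 2 powr (1 + B)) * real (n + 2) powr (- real m - 1 - Re s)"
        unfolding \<rho>_def e by simp
    qed
  qed
  moreover have "(\<lambda>s. Z (s + of_nat (i + 1))) holomorphic_on ?S" for i
  proof -
    have "Z \<circ> (\<lambda>s. s + of_nat (i + 1)) holomorphic_on ?S"
      by (rule holomorphic_on_compose_gen[OF _ Z]) (auto intro!: holomorphic_intros)
    then show ?thesis by (simp add: o_def)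
  qed
  ultimately have "Z' holomorphic_on ?S"
    unfolding Z'_def by (intro holomorphic_intros gch) auto
  moreover have "Z' s = (s - 1) * zeta_tail s" if s: "1 < Re s" for s
  proof -
    have "- (((1 - s) gchoose (i + 1)) / of_nat (i + 2) * Z (s + of_nat (i + 1)))
        = ((1 - s) gchoose (i + 2)) * zeta_tail (s + of_nat (i + 1))" for i
    proof -
      have nz: "s + of_nat i \<noteq> 0"
      proof
        assume "s + of_nat i = 0"
        then have "Re (s + of_nat i) = 0" by simp
        then show False using s by simp
      qed
      have "Z (s + of_nat (i + 1)) = (s + of_nat i) * zeta_tail (s + of_nat (i + 1))"
        using s by (subst Zt) auto
      then have "- (((1 - s) gchoose (i + 1)) / of_nat (i + 2) * Z (s + of_nat (i + 1)))
          = (- ((1 - s) gchoose (i + 1)) / of_nat (i + 2)) * ((s + of_nat i) * zeta_tail (s + of_nat (i + 1)))"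
        by simp
      also have "\<dots> = ((1 - s) gchoose (i + 2)) * zeta_tail (s + of_nat (i + 1))"
        unfolding gbinomial_over_shift[OF nz, symmetric] using nz by simp
      finally show ?thesis .
    qed
    then show ?thesis
      unfolding zeta_tail_recurrence[OF s, of m] Z'_def \<rho>_def by (simp flip: sum_negf)
  qed
  ultimately show ?case by blast
qed

text \<open>By the identity theorem the continuations to the half-planes agree wherever two of them
  are defined, so they glue.\<close>

lemma zeta_tail_entire:
  "\<exists>Z. Z holomorphic_on UNIV \<and> (\<forall>s. 1 < Re s \<longrightarrow> Z s = (s - 1) * zeta_tail s)"
proof -
  obtain Zf where Zf: "\<And>m. Zf m holomorphic_on {s. 1 - real m < Re s}"
    and Zt: "\<And>m s. 1 < Re s \<Longrightarrow> Zf m s = (s - 1) * zeta_tail s"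
    using zeta_tail_strip by metis
  have agree: "Zf m s = Zf m' s" if m: "1 - real m < Re s" "1 - real m' < Re s" for m m' s
  proof (rule analytic_continuation_open[of "{s. 1 < Re s}" "{s. 1 - real (min m m') < Re s}" "Zf m" "Zf m'"])
    show "{s. 1 < Re s} \<noteq> {}" by (auto intro: exI[of _ 2])
    show "connected {s. 1 - real (min m m') < Re s}"
      by (intro convex_connected convex_halfspace_Re_gt)
    show "Zf m holomorphic_on {s. 1 - real (min m m') < Re s}"
      "Zf m' holomorphic_on {s. 1 - real (min m m') < Re s}"
      by (rule holomorphic_on_subset[OF Zf]; auto)+
  qed (use m Zt in \<open>auto simp: open_halfspace_Re_gt min_def\<close>)
  \<comment> \<open>Any index m > 1 - Re s serves; the ceiling of 2 - Re s satisfies this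
    strictly.\<close>
  define Z where "Z s = Zf (nat \<lceil>2 - Re s\<rceil>) s" for s
  have ZZf: "Z s = Zf m s" if "1 - real m < Re s" for m s
    unfolding Z_def by (rule agree[OF _ that]) linarith
  have "Z holomorphic_on (\<Union>m. {s. 1 - real m < Re s})"
    by (intro holomorphic_on_UN_open holomorphic_transform[OF Zf] open_halfspace_Re_gt) (simp add: ZZf)
  also have "(\<Union>m. {s. 1 - real m < Re s}) = UNIV"
  proof safe
    fix s show "s \<in> (\<Union>m. {s. 1 - real m < Re s})"
      by (rule UN_I[of "nat \<lceil>2 - Re s\<rceil>"]) (auto, linarith)
  qed simp
  finally show ?thesis using ZZf[of 0] Zt by auto
qed

text \<open>Existence and uniqueness of the function described in \<open>zeta_def\<close>, so that
  the definite description denotes it.\<close>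

lemma zeta_characterization:
  shows zeta_holomorphic: "zeta holomorphic_on - {1}"
    and zeta_sums: "1 < Re s \<Longrightarrow> (\<lambda>n. of_nat (Suc n) powr (- s)) sums zeta s"
proof -
  let ?P = "\<lambda>f. f holomorphic_on (- {1}) \<and>
      (\<forall>s. Re s > 1 \<longrightarrow> (\<lambda>n. of_nat (Suc n) powr (- s)) sums f s) \<and> f (1 :: complex) = (0 :: complex)"
  obtain Z where Z: "Z holomorphic_on UNIV" "\<And>s. 1 < Re s \<Longrightarrow> Z s = (s - 1) * zeta_tail s"
    using zeta_tail_entire by blast
  \<comment> \<open>The summand 1 restores the first term of the Dirichlet series; the value at 1 is
    the one prescribed in the definition.\<close>
  define f where "f s = (if s = 1 then 0 else 1 + Z s / (s - 1))" for s
  have "?P f"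
  proof (intro conjI allI impI)
    have "(\<lambda>s. 1 + Z s / (s - 1)) holomorphic_on - {1}"
      by (intro holomorphic_intros holomorphic_on_subset[OF Z(1)]) auto
    then show "f holomorphic_on - {1}"
      by (rule holomorphic_transform) (simp add: f_def)
    fix s :: complex assume s: "Re s > 1"
    then have "s \<noteq> 1" by auto
    then have fs: "f s = zeta_tail s + of_nat (Suc 0) powr (- s)" using Z(2)[OF s] by (simp add: f_def)
    have "(\<lambda>n. of_nat (Suc (Suc n)) powr (- s)) sums zeta_tail s"
      using summable_sums[OF zeta_tail_summable[OF s]] by (simp add: zeta_tail_def)
    then show "(\<lambda>n. of_nat (Suc n) powr (- s)) sums f s" unfolding fs by (subst (asm) sums_Suc_iff) simp
  qed (simp add: f_def)
  moreover have "g = f" if "?P g" for g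
  proof
    fix s
    show "g s = f s"
    proof (cases "s = 1")
      case False
      show ?thesis
      proof (rule analytic_continuation_open[of "{s. 1 < Re s}" "- {1}" g f])
        show "{s. 1 < Re s} \<noteq> {}" by (auto intro: exI[of _ 2])
        show "connected (- {1 :: complex})" by (rule connected_punctured_universe) simp
        show "g z = f z" if "z \<in> {s. 1 < Re s}" for z
          using \<open>?P g\<close> \<open>?P f\<close> that sums_unique2 by blast
      qed (use \<open>?P g\<close> \<open>?P f\<close> False in \<open>auto simp: open_halfspace_Re_gt\<close>)
    qed (use \<open>?P g\<close> \<open>?P f\<close> in simp)
  qed
  ultimately have "?P zeta" unfolding zeta_def by (rule theI)
  then show "zeta holomorphic_on - {1}"
    "1 < Re s \<Longrightarrow> (\<lambda>n. of_nat (Suc n) powr (- s)) sums zeta s" by blast+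
qed

section \<open>Zeta is not constant on vertical lines\<close>

text \<open>Constancy on a line off the pole would spread to the whole punctured plane by the
  identity theorem, but the values at 2 and 3 differ.\<close>

lemma zeta_vertical_line_nonconstant:
  assumes "\<sigma> \<noteq> 1"
  shows "\<exists>t u. zeta (Complex \<sigma> t) \<noteq> zeta (Complex \<sigma> u)"
proof (rule ccontr)
  assume "\<not> ?thesis"
  then have const: "zeta (Complex \<sigma> t) = zeta (Complex \<sigma> 0)" for t by blast
  have zc: "zeta z = zeta (Complex \<sigma> 0)" if "z \<in> - {1}" for z
  proof -
    have lim: "Complex \<sigma> 0 islimpt range (Complex \<sigma>)"
      unfolding islimpt_approachable
    proof (intro allI impI)
      fix e :: real assume "e > 0"
      then show "\<exists>x'\<in>range (Complex \<sigma>). x' \<noteq> Complex \<sigma> 0 \<and> dist x' (Complex \<sigma> 0) < e"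
        by (intro bexI[of _ "Complex \<sigma> (e / 2)"]) (auto simp: dist_norm cmod_def complex_diff)
    qed
    have con: "connected (- {1 :: complex})" by (rule connected_punctured_universe) simp
    have "zeta z - zeta (Complex \<sigma> 0) = 0"
      by (rule analytic_continuation[OF _ _ con _ _ lim _ that, of "\<lambda>z. zeta z - zeta (Complex \<sigma> 0)"])
         (use assms const in \<open>auto simp: complex_eq_iff intro!: holomorphic_intros zeta_holomorphic\<close>)
    then show ?thesis by simp
  qed
  have sums: "(\<lambda>n. real (Suc n) powr (- x)) sums Re (zeta (of_real x))" if "1 < x" for x
  proof -
    have "of_nat (Suc n) powr (- of_real x) = complex_of_real (real (Suc n) powr (- x))" for n
      by (subst powr_of_real[symmetric]) auto
    then show ?thesis using sums_Re[OF zeta_sums[of "of_real x"]] that by simp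
  qed
  have "(\<lambda>n. real (Suc n) powr (- 2) - real (Suc n) powr (- 3)) sums 0"
    using sums_diff[OF sums[of 2] sums[of 3]] zc[of 2] zc[of 3] by simp
  moreover have "0 \<le> real (Suc n) powr (- 2) - real (Suc n) powr (- 3)" for n
    using powr_mono[of "-3" "-2" "real (Suc n)"] by simp
  \<comment> \<open>A series of nonnegative terms with sum 0 vanishes termwise; its second term
    would read 1/4 = 1/8.\<close>
  ultimately have "real (Suc 1) powr (- 2) - real (Suc 1) powr (- 3) = 0"
    using suminf_eq_zero_iff[of "\<lambda>n. real (Suc n) powr (- 2) - real (Suc n) powr (- 3)"]
    unfolding sums_iff by blast
  then show False by (simp add: powr_minus)
qed

subsection \<open>Visits with summable reciprocals\<close>

text \<open>The means converge to some L, and one of u, v has distance at least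
  \<open>2 * \<delta>\<close> from it. A late visit near that point differs from the current mean by
  more than \<open>\<delta> / 2\<close>, hence moves the mean by at least a constant over n. The
  term at 0 is harmless, since division by 0 yields 0.\<close>

lemma summable_visits_of_summable_mean_increments:
  fixes a :: "nat \<Rightarrow> complex"
  defines "R \<equiv> \<lambda>N. (\<Sum>n=1..N. a n) / of_nat N"
  assumes sm: "summable (\<lambda>N. norm (R (Suc (Suc N)) - R (Suc N)))"
    and "0 < \<delta>" "4 * \<delta> \<le> dist u v"
  shows "\<exists>w\<in>{u, v}. summable (\<lambda>n. of_bool (dist (a n) w < \<delta>) / real n)"
proof -
  \<comment> \<open>The shift avoids the empty mean: \<open>f n\<close> averages n + 1 values, so
    the next value is \<open>a (n + 2)\<close>.\<close>
  define f where "f N = R (Suc N)" for N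
  have step: "of_nat (n + 2) * (f (Suc n) - f n) = a (n + 2) - f n" for n
  proof -
    have "of_nat (n + 2) * f (Suc n) = (\<Sum>n=1..n + 2. a n)"
      unfolding f_def R_def by (simp del: of_nat_Suc of_nat_add sum.cl_ivl_Suc)
    also have "\<dots> = (\<Sum>n=1..Suc n. a n) + a (n + 2)" by simp
    also have "(\<Sum>n=1..Suc n. a n) = of_nat (Suc n) * f n"
      unfolding f_def R_def by (simp del: of_nat_Suc sum.cl_ivl_Suc)
    finally show ?thesis by (simp add: algebra_simps)
  qed
  have "summable (\<lambda>n. f (Suc n) - f n)"
    using sm unfolding f_def by (rule summable_norm_cancel)
  then have "(\<lambda>N. f N - f 0) \<longlonglongrightarrow> (\<Sum>n. f (Suc n) - f n)"
    using summable_LIMSEQ sum_lessThan_telescope[of f] by fastforce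
  then obtain L where L: "f \<longlonglongrightarrow> L"
    using tendsto_add[OF _ tendsto_const[of "f 0"]] by fastforce
  have "dist u v \<le> dist u L + dist v L" by (rule dist_triangle2)
  then have "2 * \<delta> \<le> dist u L \<or> 2 * \<delta> \<le> dist v L" using assms(4) by linarith
  then obtain w where w: "w \<in> {u, v}" "2 * \<delta> \<le> dist w L" by blast
  have ev: "\<forall>\<^sub>F n in sequentially. dist (f n) L < \<delta> / 2"
    using L \<open>0 < \<delta>\<close> by (intro tendstoD) auto
  have "\<forall>\<^sub>F n in sequentially. norm (of_bool (dist (a (n + 2)) w < \<delta>) / real (n + 2))
      \<le> 2 / \<delta> * norm (f (Suc n) - f n)"
    using ev
  proof eventually_elim
    case (elim n)
    show ?case
    proof (cases "dist (a (n + 2)) w < \<delta>")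
      case True
      have "dist w L \<le> dist (a (n + 2)) w + (dist (a (n + 2)) (f n) + dist (f n) L)"
        by (smt (verit) dist_triangle dist_commute)
      with True elim w have "\<delta> / 2 < dist (a (n + 2)) (f n)" by linarith
      also have "\<dots> = norm (of_nat (n + 2) * (f (Suc n) - f n))" unfolding step by (simp add: dist_norm)
      also have "\<dots> = real (n + 2) * norm (f (Suc n) - f n)" by (simp only: norm_mult norm_of_nat)
      finally show ?thesis using True \<open>0 < \<delta>\<close> by (simp add: field_simps)
    qed (use \<open>0 < \<delta>\<close> in simp)
  qed
  moreover have "summable (\<lambda>n. 2 / \<delta> * norm (f (Suc n) - f n))"
    using sm unfolding f_def by (rule summable_mult)
  ultimately have "summable (\<lambda>n. of_bool (dist (a (n + 2)) w < \<delta>) / real (n + 2))"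
    by (rule summable_comparison_test_ev)
  then have "summable (\<lambda>n. of_bool (dist (a n) w < \<delta>) / real n)"
    by (subst (asm) summable_iff_shift)
  then show ?thesis using w(1) by blast
qed

text \<open>A case of Kronecker's lemma: the first M terms contribute at most M/N to the mean, and
  for n from M to N the bound \<open>c n \<le> N * (c n / n)\<close> leaves a small tail of the
  convergent series.\<close>

lemma mean_tendsto_0_of_summable_divide:
  fixes c :: "nat \<Rightarrow> real"
  assumes c: "\<And>n. 0 \<le> c n" "\<And>n. c n \<le> 1" and sm: "summable (\<lambda>n. c n / real n)"
  shows "(\<lambda>N. (\<Sum>n=1..N. c n) / real N) \<longlonglongrightarrow> 0"
proof (rule LIMSEQ_I)
  fix e :: real assume "0 < e"
  then obtain M\<^sub>0 where M\<^sub>0: "\<And>m n. M\<^sub>0 \<le> m \<Longrightarrow> norm (\<Sum>k=m..<n. c k / real k) < e / 2"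
    using sm[unfolded summable_Cauchy] by (meson half_gt_zero)
  \<comment> \<open>The successor makes M positive, so that n is nonzero in the tail.\<close>
  define M where "M = Suc M\<^sub>0"
  have "(\<lambda>N. real M / real N) \<longlonglongrightarrow> 0" by real_asymp
  then have "\<forall>\<^sub>F N in sequentially. real M / real N < e / 2"
    using \<open>0 < e\<close> by (intro order_tendstoD) auto
  then have "\<forall>\<^sub>F N in sequentially. norm ((\<Sum>n=1..N. c n) / real N - 0) < e"
    using eventually_gt_at_top[of 0]
  proof eventually_elim
    case (elim N)
    have "(\<Sum>n=1..N. c n) \<le> (\<Sum>n\<in>{..<M} \<union> {M..<Suc N}. c n)"
      using c by (intro sum_mono2) auto
    also have "\<dots> = (\<Sum>n<M. c n) + (\<Sum>n=M..<Suc N. c n)"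
      by (rule sum.union_disjoint) auto
    also have "(\<Sum>n<M. c n) \<le> real M" using sum_mono[of "{..<M}" c "\<lambda>_. 1"] c by simp
    also have "(\<Sum>n=M..<Suc N. c n) \<le> (\<Sum>n=M..<Suc N. real N * (c n / real n))"
    proof (rule sum_mono)
      fix n assume n: "n \<in> {M..<Suc N}"
      then have "real n * c n \<le> real N * c n" using c(1) by (intro mult_right_mono) auto
      then show "c n \<le> real N * (c n / real n)" using n by (simp add: M_def field_simps)
    qed
    also have "\<dots> = real N * (\<Sum>n=M..<Suc N. c n / real n)" by (simp only: sum_distrib_left)
    also have "\<dots> \<le> real N * (e / 2)"
      using M\<^sub>0[of M "Suc N"] by (intro mult_left_mono) (auto simp: M_def)
    finally have "(\<Sum>n=1..N. c n) / real N \<le> real M / real N + e / 2"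
      using elim by (simp add: field_simps)
    moreover have "0 \<le> (\<Sum>n=1..N. c n) / real N" using c by (simp add: sum_nonneg)
    ultimately show ?case using elim unfolding diff_zero real_norm_def by linarith
  qed
  then show "\<exists>no. \<forall>n\<ge>no. norm ((\<Sum>n=1..n. c n) / real n - 0) < e"
    by (simp only: eventually_sequentially)
qed

section \<open>Second moments and close pairs of times\<close>

text \<open>The visit frequency \<open>F N\<close> tends to q in mean square, since only pairs in
  \<open>D\<close> can be correlated. On the set \<open>E\<close> where the series converges it
  tends to 0 pointwise. Computing the limit of the integral of \<open>(F N - q)\<^sup>2\<close> over
  \<open>E\<close> in both ways forces \<open>E\<close> to be null.\<close>

lemma (in prob_space) AE_not_summable_visits:
  assumes A [measurable]: "\<And>n. A n \<in> events" and q: "0 < q" and pA: "\<And>n. prob (A n) = q"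
    and pAA: "\<And>i j. (i, j) \<notin> D \<Longrightarrow> prob (A i \<inter> A j) = q\<^sup>2"
    and D: "(\<lambda>N. real (card (D \<inter> {1..N} \<times> {1..N})) / (real N)\<^sup>2) \<longlonglongrightarrow> 0"
  shows "AE x in M. \<not> summable (\<lambda>n. indicator (A n) x / real n :: real)"
proof -
  define F where "F N x = (\<Sum>n=1..N. indicator (A n) x) / real N" for N x
  \<comment> \<open>Summing in \<open>ennreal\<close> expresses convergence as finiteness and makes
    the set visibly measurable.\<close>
  define E where "E = {x \<in> space M. (\<Sum>n. ennreal (indicator (A n) x / real n)) \<noteq> \<top>}"
  have E [measurable]: "E \<in> events" unfolding E_def by measurable
  have F [measurable]: "F N \<in> borel_measurable M" for N unfolding F_def by measurable
  have q1: "q \<le> 1" using pA[of 0] prob_le_1 by metis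
  have F01: "0 \<le> F N x" "F N x \<le> 1" for N x
  proof -
    show "0 \<le> F N x" by (simp add: F_def sum_nonneg)
    have "(\<Sum>n=1..N. indicator (A n) x) \<le> (\<Sum>n=1..N. 1 :: real)"
      by (intro sum_mono indicator_le_1)
    then show "F N x \<le> 1" by (cases "N = 0") (simp_all add: F_def)
  qed
  have sq1: "(F N x - q)\<^sup>2 \<le> 1" for N x
    using F01[of N x] q q1 unfolding abs_square_le_1 by (simp add: abs_le_iff)
  have int: "integrable M (\<lambda>x. (F N x - q)\<^sup>2)" for N
    by (rule integrable_const_bound[of _ 1]) (use sq1 in auto)
  have second_moment: "expectation (\<lambda>x. (F N x - q)\<^sup>2) \<le> real (card (D \<inter> {1..N} \<times> {1..N})) / (real N)\<^sup>2"
    if N: "0 < N" for N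
  proof -
    let ?P = "{1..N} \<times> {1..N}"
    define S\<^sub>1 where "S\<^sub>1 x = (\<Sum>n=1..N. indicator (A n) x :: real)" for x
    define S\<^sub>2 where "S\<^sub>2 x = (\<Sum>z\<in>?P. indicator (A (fst z) \<inter> A (snd z)) x :: real)" for x
    have ind: "integrable M (indicator B :: 'a \<Rightarrow> real)" if "B \<in> events" for B
      using that by (intro integrable_real_indicator) (auto simp: emeasure_eq_measure)
    have S\<^sub>1: "integrable M S\<^sub>1" "expectation S\<^sub>1 = (\<Sum>n=1..N. prob (A n))"
      unfolding S\<^sub>1_def by (auto intro!: Bochner_Integration.integrable_sum ind A simp: Bochner_Integration.integral_sum ind A)
    have S\<^sub>2: "integrable M S\<^sub>2" "expectation S\<^sub>2 = (\<Sum>z\<in>?P. prob (A (fst z) \<inter> A (snd z)))"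
      unfolding S\<^sub>2_def by (auto intro!: Bochner_Integration.integrable_sum ind A simp: Bochner_Integration.integral_sum ind A)
    have "(S\<^sub>1 x)\<^sup>2 = S\<^sub>2 x" for x
      unfolding S\<^sub>1_def S\<^sub>2_def
      by (simp only: power2_eq_square sum_product sum.cartesian_product indicator_inter_arith case_prod_unfold)
    then have "(F N x - q)\<^sup>2 = S\<^sub>2 x / (real N)\<^sup>2 - 2 * q / real N * S\<^sub>1 x + q\<^sup>2" for x
      unfolding F_def power2_diff power_divide S\<^sub>1_def[symmetric] by simp
    then have "expectation (\<lambda>x. (F N x - q)\<^sup>2)
        = expectation (\<lambda>x. S\<^sub>2 x / (real N)\<^sup>2 - 2 * q / real N * S\<^sub>1 x + q\<^sup>2)" by presburger
    also have "\<dots> = (\<Sum>(i,j)\<in>?P. prob (A i \<inter> A j)) / (real N)\<^sup>2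
        - 2 * q / real N * (\<Sum>n=1..N. prob (A n)) + q\<^sup>2"
      unfolding case_prod_beta S\<^sub>1(2)[symmetric] S\<^sub>2(2)[symmetric]
      using S\<^sub>1(1) S\<^sub>2(1) by (simp add: prob_space)
    also have "\<dots> = (\<Sum>(i,j)\<in>?P. prob (A i \<inter> A j)) / (real N)\<^sup>2 - q\<^sup>2"
      using N by (simp add: pA power2_eq_square)
    \<comment> \<open>Pairs outside \<open>D\<close> contribute exactly \<open>q\<^sup>2\<close>,
      pairs in \<open>D\<close> at most 1. The main term then cancels against
      \<open>- q\<^sup>2\<close>.\<close>
    also have "(\<Sum>(i,j)\<in>?P. prob (A i \<inter> A j)) \<le> (\<Sum>z\<in>?P. q\<^sup>2 + indicator D z)"
    proof (rule sum_mono, safe)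
      fix i j
      show "prob (A i \<inter> A j) \<le> q\<^sup>2 + indicator D (i, j)"
        using pAA[of i j] prob_le_1[of "A i \<inter> A j"] by (cases "(i, j) \<in> D") (auto intro: add_increasing)
    qed
    also have "\<dots> = (real N)\<^sup>2 * q\<^sup>2 + real (card (D \<inter> ?P))"
      by (simp add: sum.distrib indicator_def Int_commute power2_eq_square flip: sum.inter_restrict)
    finally show ?thesis using N by (simp add: divide_right_mono add_divide_distrib)
  qed
  have lim0: "(\<lambda>N. expectation (\<lambda>x. indicator E x * (F N x - q)\<^sup>2)) \<longlonglongrightarrow> 0"
  proof (rule tendsto_sandwich[OF _ _ tendsto_const D])
    show "\<forall>\<^sub>F N in sequentially. 0 \<le> expectation (\<lambda>x. indicator E x * (F N x - q)\<^sup>2)"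
      by (simp add: integral_nonneg)
    show "\<forall>\<^sub>F N in sequentially. expectation (\<lambda>x. indicator E x * (F N x - q)\<^sup>2)
        \<le> real (card (D \<inter> {1..N} \<times> {1..N})) / (real N)\<^sup>2"
      using eventually_gt_at_top[of 0]
    proof eventually_elim
      case (elim N)
      have "expectation (\<lambda>x. indicator E x * (F N x - q)\<^sup>2) \<le> expectation (\<lambda>x. (F N x - q)\<^sup>2)"
        by (intro integral_mono' int) (auto simp: indicator_def)
      then show ?case using second_moment[OF elim] by linarith
    qed
  qed
  have lim1: "(\<lambda>N. expectation (\<lambda>x. indicator E x * (F N x - q)\<^sup>2)) \<longlonglongrightarrow> expectation (\<lambda>x. indicator E x * (0 - q)\<^sup>2)"
  proof (rule integral_dominated_convergence[where w = "\<lambda>_. 1"])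
    show "AE x in M. (\<lambda>N. indicator E x * (F N x - q)\<^sup>2) \<longlonglongrightarrow> indicator E x * (0 - q)\<^sup>2"
    proof (rule AE_I2)
      fix x
      show "(\<lambda>N. indicator E x * (F N x - q)\<^sup>2) \<longlonglongrightarrow> indicator E x * (0 - q)\<^sup>2"
      proof (cases "x \<in> E")
        case True
        then have "summable (\<lambda>n. indicator (A n) x / real n :: real)"
          unfolding E_def by (intro summable_suminf_not_top) auto
        then have "(\<lambda>N. F N x) \<longlonglongrightarrow> 0"
          unfolding F_def
          by (rule mean_tendsto_0_of_summable_divide[rotated 2]) (simp_all add: indicator_le_1)
        then show ?thesis
          by (rule tendsto_mult[OF tendsto_const tendsto_power[OF tendsto_diff[OF _ tendsto_const]]])
      qed simp
    qed
    show "AE x in M. norm (indicator E x * (F N x - q)\<^sup>2) \<le> 1" for N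
    proof (rule AE_I2)
      fix x
      have "indicator E x * (F N x - q)\<^sup>2 \<le> 1 * 1"
        by (intro mult_mono indicator_le_1 sq1) simp_all
      then show "norm (indicator E x * (F N x - q)\<^sup>2) \<le> 1" by (simp add: abs_mult)
    qed
    show "(\<lambda>x. indicator E x * (F N x - q)\<^sup>2) \<in> borel_measurable M" for N by measurable
    show "(\<lambda>x. indicator E x * (0 - q)\<^sup>2) \<in> borel_measurable M" by measurable
  qed simp
  have "prob E * q\<^sup>2 = 0"
    using LIMSEQ_unique[OF lim0 lim1] by simp
  then have "prob E = 0" using q by simp
  then have "AE x in M. x \<notin> E" by (simp add: prob_eq_0)
  then show ?thesis
  proof (rule AE_mp, intro AE_I2 impI notI)
    fix x assume x: "x \<in> space M" "x \<notin> E" and sm: "summable (\<lambda>n. indicator (A n) x / real n :: real)"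
    have "(\<Sum>n. ennreal (indicator (A n) x / real n)) \<noteq> \<top>"
      by (rule ennreal_suminf_neq_top[OF sm]) simp
    then show False using x unfolding E_def by blast
  qed
qed

text \<open>For fixed i, a close partner j has \<open>k j\<close> among at most 2m + 1 values. Each
  value lies in one residue class modulo M, which for large N is hit by fewer than 2N/M indices up
  to N. Repeated values of k are thereby controlled as well, and M is arbitrary.\<close>

lemma close_pairs_density_zero:
  assumes ud: "\<And>M. 1 < M \<Longrightarrow> uniformly_distributed_residues M k"
  shows "(\<lambda>N. real (card ({(i, j). k i < k j + m \<and> k j < k i + m} \<inter> {1..N} \<times> {1..N})) / (real N)\<^sup>2) \<longlonglongrightarrow> 0"
    (is "(\<lambda>N. real (card (?D \<inter> _)) / _) \<longlonglongrightarrow> 0")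
proof (rule tendstoI)
  fix e :: real assume e: "0 < e"
  \<comment> \<open>Chosen so that the final density bound 2(2m + 1)/M is below e; the factor 2 is
    the slack in 2/M over the limit 1/M.\<close>
  obtain M where M: "2 * real (2 * m + 1) / e < real M" "1 < M"
    by (metis reals_Archimedean2 max_less_iff_conj of_nat_less_iff)
  have "\<forall>\<^sub>F N in sequentially. \<forall>r\<in>{..<M}. real (card {n\<in>{1..N}. k n mod M = r}) / real N < 2 / real M"
  proof (intro eventually_ball_finite ballI)
    fix r assume "r \<in> {..<M}"
    then have "(\<lambda>N. real (card {n\<in>{1..N}. k n mod M = r}) / real N) \<longlonglongrightarrow> 1 / real M"
      using ud[OF M(2)] by (simp add: uniformly_distributed_residues_def)
    then show "\<forall>\<^sub>F N in sequentially. real (card {n\<in>{1..N}. k n mod M = r}) / real N < 2 / real M"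
      using M(2) by (intro order_tendstoD(2)) (auto simp: divide_strict_right_mono)
  qed simp
  then show "\<forall>\<^sub>F N in sequentially. dist (real (card (?D \<inter> {1..N} \<times> {1..N})) / (real N)\<^sup>2) 0 < e"
    using eventually_gt_at_top[of 0]
  proof eventually_elim
    case (elim N)
    let ?C = "\<lambda>i. {j\<in>{1..N}. (i, j) \<in> ?D}"
    have C: "real (card (?C i)) \<le> real (2 * m + 1) * (2 / real M * real N)" for i
    proof -
      \<comment> \<open>Truncated subtraction can only shorten this window.\<close>
      let ?V = "{k i - m..k i + m}"
      have "?C i \<subseteq> (\<Union>v\<in>?V. {j\<in>{1..N}. k j mod M = v mod M})"
      proof
        fix j assume "j \<in> ?C i"
        then show "j \<in> (\<Union>v\<in>?V. {j\<in>{1..N}. k j mod M = v mod M})"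
          by (intro UN_I[of "k j"]) auto
      qed
      then have "card (?C i) \<le> card (\<Union>v\<in>?V. {j\<in>{1..N}. k j mod M = v mod M})"
        by (intro card_mono) auto
      also have "\<dots> \<le> (\<Sum>v\<in>?V. card {j\<in>{1..N}. k j mod M = v mod M})" by (rule card_UN_le) simp
      finally have "real (card (?C i)) \<le> (\<Sum>v\<in>?V. real (card {j\<in>{1..N}. k j mod M = v mod M}))"
        by (simp flip: of_nat_sum)
      also have "\<dots> \<le> (\<Sum>v\<in>?V. 2 / real M * real N)"
      proof (rule sum_mono)
        fix v
        have "v mod M \<in> {..<M}" using M(2) by simp
        then have "real (card {j\<in>{1..N}. k j mod M = v mod M}) / real N < 2 / real M"
          using elim(1) by blast
        then show "real (card {j\<in>{1..N}. k j mod M = v mod M}) \<le> 2 / real M * real N"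
          using elim(2) by (simp add: divide_less_eq)
      qed
      also have "\<dots> = real (card ?V) * (2 / real M * real N)" by simp
      also have "\<dots> \<le> real (2 * m + 1) * (2 / real M * real N)"
        by (intro mult_right_mono) auto
      finally show ?thesis .
    qed
    have "?D \<inter> {1..N} \<times> {1..N} = (SIGMA i:{1..N}. ?C i)" by auto
    then have "real (card (?D \<inter> {1..N} \<times> {1..N})) = (\<Sum>i\<in>{1..N}. real (card (?C i)))"
      by (simp add: card_SigmaI)
    also have "\<dots> \<le> (\<Sum>i\<in>{1..N}. real (2 * m + 1) * (2 / real M * real N))" by (rule sum_mono) (rule C)
    also have "\<dots> = (2 * real (2 * m + 1) / real M) * (real N)\<^sup>2" by (simp add: power2_eq_square)
    also have "\<dots> < e * (real N)\<^sup>2"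
      using M e elim(2) by (intro mult_strict_right_mono) (auto simp: field_simps)
    finally show ?case using elim(2) by (simp add: divide_less_eq)
  qed
qed

section \<open>The doubling map on the unit interval\<close>

lemma nn_integral_periodic_interval:
  fixes F :: "real \<Rightarrow> ennreal"
  assumes [measurable]: "F \<in> borel_measurable borel" and per: "\<And>x. F (x + 1) = F x"
  shows "(\<integral>\<^sup>+x. F x * indicator {real i..<real (i + r)} x \<partial>lborel)
       = of_nat r * (\<integral>\<^sup>+x. F x * indicator {0..<1} x \<partial>lborel)"
proof (induction r)
  case (Suc r)
  have pern: "F (real n + x) = F x" for n x
    by (induction n) (simp, metis per add.commute add.left_commute of_nat_Suc)
  have "(\<integral>\<^sup>+x. F x * indicator {real (i + r)..<real (i + r) + 1} x \<partial>lborel)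
      = (\<integral>\<^sup>+x. F (real (i + r) + x) * indicator {real (i + r)..<real (i + r) + 1} (real (i + r) + x) \<partial>lborel)"
    using nn_integral_real_affine[of "\<lambda>x. F x * indicator {real (i + r)..<real (i + r) + 1} x" 1 "real (i + r)"]
    by simp
  also have "\<dots> = (\<integral>\<^sup>+x. F x * indicator {0..<1} x \<partial>lborel)"
    unfolding pern by (intro nn_integral_cong) (auto simp: indicator_def)
  finally have one: "(\<integral>\<^sup>+x. F x * indicator {real (i + r)..<real (i + r) + 1} x \<partial>lborel)
      = (\<integral>\<^sup>+x. F x * indicator {0..<1} x \<partial>lborel)" .
  have "(\<integral>\<^sup>+x. F x * indicator {real i..<real (i + Suc r)} x \<partial>lborel)
      = (\<integral>\<^sup>+x. F x * indicator {real i..<real (i + r)} x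
            + F x * indicator {real (i + r)..<real (i + r) + 1} x \<partial>lborel)"
    by (intro nn_integral_cong) (auto simp: indicator_def)
  also have "\<dots> = of_nat r * (\<integral>\<^sup>+x. F x * indicator {0..<1} x \<partial>lborel)
      + (\<integral>\<^sup>+x. F x * indicator {0..<1} x \<partial>lborel)"
    by (subst nn_integral_add) (simp_all only: Suc.IH one, measurable)
  finally show ?case by (simp add: distrib_right add.commute)
qed simp

text \<open>The substitution y = b r x carries the interval onto r full periods. Taking b = 1 gives
  invariance of the measure under dilation, and b = 2^m gives independence from a dyadic interval of
  level m.\<close>

lemma nn_integral_periodic_dilate:
  fixes F :: "real \<Rightarrow> ennreal" and b r :: nat
  assumes [measurable]: "F \<in> borel_measurable borel" and per: "\<And>x. F (x + 1) = F x"
    and "0 < b" "0 < r"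
  shows "of_nat b * (\<integral>\<^sup>+x. F (real (b * r) * x) * indicator {real j / real b..<real (j + 1) / real b} x \<partial>lborel)
       = (\<integral>\<^sup>+x. F x * indicator {0..<1} x \<partial>lborel)" (is "_ * ?L = ?I")
proof -
  have pos: "0 < real (b * r)" using assms by simp
  have "of_nat r * ?I = (\<integral>\<^sup>+x. F x * indicator {real (j * r)..<real (j * r + r)} x \<partial>lborel)"
    by (rule nn_integral_periodic_interval[symmetric]) (use per in auto)
  also have "\<dots> = ennreal (real (b * r)) * (\<integral>\<^sup>+x. F (real (b * r) * x)
      * indicator {real (j * r)..<real (j * r + r)} (real (b * r) * x) \<partial>lborel)"
    using nn_integral_real_affine[of "\<lambda>x. F x * indicator {real (j * r)..<real (j * r + r)} x" "real (b * r)" 0] pos assms(3,4)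
    by simp
  also have "(\<integral>\<^sup>+x. F (real (b * r) * x)
      * indicator {real (j * r)..<real (j * r + r)} (real (b * r) * x) \<partial>lborel) = ?L"
  proof (intro nn_integral_cong)
    fix x
    have "real (j * r) \<le> real (b * r) * x \<longleftrightarrow> real j / real b \<le> x"
      using assms(3,4) by (simp add: divide_le_eq mult_ac)
    moreover have "real (b * r) * x < real (j * r + r) \<longleftrightarrow> x < real (j + 1) / real b"
    proof -
      have "real (b * r) * x < real (j * r + r) \<longleftrightarrow> real r * (x * real b) < real r * real (j + 1)"
        by (simp add: algebra_simps)
      then show ?thesis using assms(3,4) by (simp add: less_divide_eq)
    qed
    ultimately show "F (real (b * r) * x) * indicator {real (j * r)..<real (j * r + r)} (real (b * r) * x)
        = F (real (b * r) * x) * indicator {real j / real b..<real (j + 1) / real b} x"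
      by (simp add: indicator_def)
  qed
  finally have "of_nat r * ?I = of_nat r * (of_nat b * ?L)"
    by (simp add: ennreal_of_nat_eq_real_of_nat ennreal_mult mult_ac)
  then show ?thesis
    using assms(4) by (subst (asm) ennreal_mult_cancel_left) auto
qed


text \<open>The visit sets all have measure 2^-m by invariance. After a visit at time
  \<open>k a\<close>, the dyadic interval fixes only the next m binary digits, so a visit at least m
  steps later is independent of it.\<close>

lemma doubling_map_visits:
  assumes ud: "\<And>M. 1 < M \<Longrightarrow> uniformly_distributed_residues M k" and j: "j < 2 ^ m"
  shows "negligible {\<theta>\<in>{0..<1}. summable (\<lambda>n.
    of_bool (frac (2 ^ k n * \<theta>) \<in> {real j / 2 ^ m..<real (j + 1) / 2 ^ m}) / real n)}"
proof -
  let ?J = "{real j / 2 ^ m..<real (j + 1) / 2 ^ m}"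
  let ?M = "restrict_space lborel {0..<1 :: real}"
  define f :: "real \<Rightarrow> ennreal" where "f x = indicator ?J (frac x)" for x
  have fm [measurable]: "f \<in> borel_measurable borel" unfolding f_def frac_def by measurable
  have fper: "f (x + 1) = f x" for x by (simp add: f_def frac_1_eq)
  have J01: "?J \<subseteq> {0..<1}"
  proof -
    have "real (j + 1) \<le> real (2 ^ m)" using j by (intro of_nat_mono) simp
    then have "real (j + 1) / 2 ^ m \<le> 1" by (simp add: divide_le_eq)
    moreover have "0 \<le> real j / 2 ^ m" by simp
    ultimately have "x \<in> {0..<1}" if "x \<in> ?J" for x
      using that unfolding atLeastLessThan_iff by linarith
    then show ?thesis by blast
  qed
  have fJ: "f x * indicator {0..<1} x = indicator ?J x" for x
    using subsetD[OF J01, of x] by (cases "x \<in> {0..<1}") (simp_all add: f_def frac_eq_id indicator_def)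
  have If: "(\<integral>\<^sup>+x. f x * indicator {0..<1} x \<partial>lborel) = ennreal (1 / 2 ^ m)"
    unfolding fJ by (simp add: divide_simps)
  define A where "A n = {\<theta>\<in>{0..<1 :: real}. frac (2 ^ k n * \<theta>) \<in> ?J}" for n
  interpret prob_space ?M by (rule prob_space_restrict_space) auto
  have Ab: "A n \<in> sets borel" for n unfolding A_def frac_def by measurable
  have A: "A n \<in> sets ?M" for n using Ab[of n] by (auto simp: sets_restrict_space_iff A_def)
  have emA: "emeasure ?M B = emeasure lborel B" if "B \<subseteq> {0..<1}" for B
    using that by (intro emeasure_restrict_space) auto
  have emA': "emeasure ?M B = (\<integral>\<^sup>+x. indicator B x \<partial>lborel)" if "B \<subseteq> {0..<1}" "B \<in> sets borel" for B
    using that by (simp add: emA)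
  have Asub: "A n \<subseteq> {0..<1}" for n by (auto simp: A_def)
  have dil: "(\<integral>\<^sup>+x. G (2 ^ n * x) * indicator {0..<1} x \<partial>lborel)
      = (\<integral>\<^sup>+x. G x * indicator {0..<1} x \<partial>lborel)"
    if "G \<in> borel_measurable borel" "\<And>x. G (x + 1) = G x" for G :: "real \<Rightarrow> ennreal" and n :: nat
    using nn_integral_periodic_dilate[OF that, of 1 "2 ^ n" 0] by simp
  have pA: "prob (A n) = 1 / 2 ^ m" for n
  proof -
    have "emeasure ?M (A n) = (\<integral>\<^sup>+x. indicator (A n) x \<partial>lborel)"
      by (intro emA' Asub Ab)
    also have "\<dots> = (\<integral>\<^sup>+x. f (2 ^ k n * x) * indicator {0..<1} x \<partial>lborel)"
      by (intro nn_integral_cong) (auto simp: A_def f_def indicator_def)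
    also have "\<dots> = ennreal (1 / 2 ^ m)" unfolding dil[OF fm fper] by (rule If)
    finally show ?thesis by (simp add: measure_def)
  qed
  have pAA': "prob (A a \<inter> A b) = (1 / 2 ^ m)\<^sup>2" if ab: "k a + m \<le> k b" for a b
  proof -
    obtain d where d: "k b = k a + (m + d)" using le_Suc_ex[OF ab] by (auto simp: add.assoc)
    \<comment> \<open>The joint indicator with the common factor \<open>2 ^ k a\<close> taken out.
      Periodicity of \<open>G\<close> lets invariance remove that factor; what is left is a periodic
      function dilated by 2^m 2^d and integrated over one interval of level m.\<close>
    define G where "G x = f x * f (2 ^ (m + d) * x)" for x
    have Gm: "G \<in> borel_measurable borel" unfolding G_def by measurable
    have fper': "f (x + real n) = f x" for x n
    proof (induction n)
      case (Suc n)
      have "f (x + real (Suc n)) = f (x + real n + 1)" by (simp add: ac_simps)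
      then show ?case using Suc fper by simp
    qed simp
    have Gper: "G (x + 1) = G x" for x
      using fper'[of "2 ^ (m + d) * x" "2 ^ (m + d)"] by (simp add: G_def fper distrib_left)
    have "emeasure ?M (A a \<inter> A b) = (\<integral>\<^sup>+x. indicator (A a \<inter> A b) x \<partial>lborel)"
      by (intro emA' le_infI1 Asub sets.Int Ab)
    also have "\<dots> = (\<integral>\<^sup>+x. G (2 ^ k a * x) * indicator {0..<1} x \<partial>lborel)"
    proof (intro nn_integral_cong)
      fix x :: real
      have e: "2 ^ k b * x = 2 ^ (m + d) * (2 ^ k a * x)" by (simp add: d power_add)
      show "indicator (A a \<inter> A b) x = G (2 ^ k a * x) * indicator {0..<1} x"
        unfolding A_def f_def G_def e[symmetric]
        by (auto simp: indicator_def simp del: atLeastLessThan_iff)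
    qed
    also have "\<dots> = (\<integral>\<^sup>+x. G x * indicator {0..<1} x \<partial>lborel)" by (rule dil[OF Gm Gper])
    also have "\<dots> = (\<integral>\<^sup>+x. f (2 ^ (m + d) * x) * indicator ?J x \<partial>lborel)"
      unfolding G_def by (intro nn_integral_cong) (simp only: fJ[symmetric] mult_ac)
    finally have e: "emeasure ?M (A a \<inter> A b) = (\<integral>\<^sup>+x. f (2 ^ (m + d) * x) * indicator ?J x \<partial>lborel)" .
    have "of_nat (2 ^ m) * emeasure ?M (A a \<inter> A b) = ennreal (1 / 2 ^ m)"
      using nn_integral_periodic_dilate[OF fm fper, of "2 ^ m" "2 ^ d" j] unfolding e If
      by (simp add: power_add)
    then have "ennreal (2 ^ m * prob (A a \<inter> A b)) = ennreal (1 / 2 ^ m)"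
      by (simp add: emeasure_eq_measure ennreal_of_nat_eq_real_of_nat ennreal_mult)
    then have "2 ^ m * prob (A a \<inter> A b) = 1 / 2 ^ m" by (subst (asm) ennreal_inj) auto
    moreover have "prob (A a \<inter> A b) = 2 ^ m * prob (A a \<inter> A b) / 2 ^ m" by simp
    ultimately show ?thesis by (simp add: power2_eq_square)
  qed
  have "AE \<theta> in ?M. \<not> summable (\<lambda>n. indicator (A n) \<theta> / real n :: real)"
  proof (rule AE_not_summable_visits[where q = "1 / 2 ^ m" and D = "{(i, j). k i < k j + m \<and> k j < k i + m}"])
    fix a b assume "(a, b) \<notin> {(i, j). k i < k j + m \<and> k j < k i + m}"
    then have "k a + m \<le> k b \<or> k b + m \<le> k a" by auto
    then show "prob (A a \<inter> A b) = (1 / 2 ^ m)\<^sup>2"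
      using pAA'[of a b] pAA'[of b a] by (auto simp: Int_commute)
  qed (use A pA close_pairs_density_zero[OF ud] in auto)
  then have "AE \<theta> in lborel. \<theta> \<in> {0..<1} \<longrightarrow> \<not> summable (\<lambda>n. indicator (A n) \<theta> / real n :: real)"
    by (subst (asm) AE_restrict_space_iff) auto
  \<comment> \<open>Passing to the completion turns the exceptional set into a negligible one, the
    notion preserved by differentiable images later.\<close>
  then have "AE \<theta> in lebesgue. \<theta> \<in> {0..<1} \<longrightarrow> \<not> summable (\<lambda>n. indicator (A n) \<theta> / real n :: real)"
    by (rule AE_completion)
  then obtain N where N: "{\<theta> \<in> space lebesgue. \<not> (\<theta> \<in> {0..<1} \<longrightarrow> \<not> summable (\<lambda>n. indicator (A n) \<theta> / real n :: real))} \<subseteq> N"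
    "emeasure lebesgue N = 0" "N \<in> sets lebesgue"
    by (rule AE_E)
  then have "negligible N" by (simp add: negligible_iff_null_sets null_sets_def)
  then show ?thesis
  proof (rule negligible_subset)
    have ind: "indicator (A n) \<theta> = (of_bool (frac (2 ^ k n * \<theta>) \<in> ?J) :: real)" if "\<theta> \<in> {0..<1}" for \<theta> n
      using that by (simp add: A_def indicator_def del: atLeastLessThan_iff)
    show "{\<theta>\<in>{0..<1}. summable (\<lambda>n. of_bool (frac (2 ^ k n * \<theta>) \<in> ?J) / real n)} \<subseteq> N"
    proof
      fix \<theta> assume \<theta>: "\<theta> \<in> {\<theta>\<in>{0..<1}. summable (\<lambda>n. of_bool (frac (2 ^ k n * \<theta>) \<in> ?J) / real n)}"
      then have "\<theta> \<in> {0..<1}" by blast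
      then have "summable (\<lambda>n. indicator (A n) \<theta> / real n :: real)" unfolding ind[OF \<open>\<theta> \<in> {0..<1}\<close>] using \<theta> by blast
      then show "\<theta> \<in> N" using N(1) \<open>\<theta> \<in> {0..<1}\<close> by (auto simp del: atLeastLessThan_iff)
    qed
  qed
qed

section \<open>Conjugation by the cotangent and transfer to the real line\<close>

text \<open>The double angle formula for the cotangent. Where sine or cosine vanishes, both sides
  are 0, because division by 0 yields 0 and \<open>boole_map 0 = 0\<close>.\<close>

lemma boole_map_cot: "boole_map (cot (pi * x)) = cot (pi * (2 * x))"
proof -
  have e: "pi * (2 * x) = 2 * (pi * x)" by simp
  show ?thesis
  proof (cases "sin (pi * x) = 0 \<or> cos (pi * x) = 0")
    case True
    then show ?thesis unfolding e cot_def sin_double by (auto simp: boole_map_def)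
  next
    case False
    then show ?thesis unfolding e cot_def sin_double cos_double boole_map_def
      by (simp add: field_simps power2_eq_square)
  qed
qed

lemma boole_map_funpow_cot: "(boole_map ^^ n) (cot (pi * x)) = cot (pi * frac (2 ^ n * x))"
proof -
  have "(boole_map ^^ n) (cot (pi * x)) = cot (pi * (2 ^ n * x))"
    by (induction n) (simp_all add: boole_map_cot mult.assoc)
  also have "\<dots> = cot (pi * frac (2 ^ n * x) + pi * of_int \<lfloor>2 ^ n * x\<rfloor>)"
    unfolding distrib_left[symmetric] by (simp add: frac_def)
  also have "\<dots> = cot (pi * frac (2 ^ n * x))"
    unfolding cot_def sin_add cos_add by (simp add: cos_npi_int sin_npi_int)
  finally show ?thesis .
qed

lemma cot_pi_surj:
  obtains \<theta> where "0 < \<theta>" "\<theta> < 1" "cot (pi * \<theta>) = x"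
proof
  show "0 < (pi / 2 - arctan x) / pi" "(pi / 2 - arctan x) / pi < 1"
    using arctan_bounded[of x] by (simp_all add: field_simps)
  show "cot (pi * ((pi / 2 - arctan x) / pi)) = x"
    by (simp add: arctan flip: tan_cot')
qed

text \<open>Continuity at a preimage of t under the cotangent gives a neighbourhood, which contains
  the dyadic interval around that point once 2^-m is small enough.\<close>

lemma dyadic_interval_of_value:
  fixes g :: "real \<Rightarrow> complex"
  assumes g: "continuous_on UNIV g" and "0 < \<delta>"
  obtains j m where "j < 2 ^ m"
    "\<And>\<theta>. \<theta> \<in> {real j / 2 ^ m..<real (j + 1) / 2 ^ m} \<Longrightarrow> dist (g (cot (pi * \<theta>))) (g t) < \<delta>"
proof -
  obtain \<alpha> where \<alpha>: "0 < \<alpha>" "\<alpha> < 1" "cot (pi * \<alpha>) = t" by (rule cot_pi_surj)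
  have "sin (pi * \<alpha>) \<noteq> 0" using \<alpha> sin_gt_zero[of "pi * \<alpha>"] by simp
  then have "isCont (\<lambda>\<theta>. cot (pi * \<theta>)) \<alpha>" by (intro continuous_intros) auto
  moreover have "isCont g (cot (pi * \<alpha>))" using g by (simp add: continuous_on_eq_continuous_at)
  ultimately have "isCont (\<lambda>\<theta>. g (cot (pi * \<theta>))) \<alpha>" by (rule isCont_o2)
  then obtain d where d: "0 < d" "\<And>\<theta>. dist \<theta> \<alpha> < d \<Longrightarrow> dist (g (cot (pi * \<theta>))) (g t) < \<delta>"
    using \<open>0 < \<delta>\<close> \<alpha>(3) unfolding continuous_at_eps_delta by metis
  obtain m where "(1 / 2) ^ m < d" using real_arch_pow_inv[of d "1 / 2"] d(1) by auto
  then have m: "1 / 2 ^ m < d" by (simp add: power_one_over)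
  define j where "j = nat \<lfloor>\<alpha> * 2 ^ m\<rfloor>"
  have j: "real j \<le> \<alpha> * 2 ^ m" "\<alpha> * 2 ^ m < real j + 1"
    unfolding j_def using \<alpha>(1) by (simp_all add: of_nat_nat zero_le_floor)
  have "real j < real (2 ^ m)" using j(1) \<alpha>(2) by (rule_tac le_less_trans) (auto intro: mult_strict_right_mono)
  then have "j < 2 ^ m" by (simp only: of_nat_less_iff)
  moreover have "dist \<theta> \<alpha> < d" if "\<theta> \<in> {real j / 2 ^ m..<real (j + 1) / 2 ^ m}" for \<theta>
  proof -
    have "real j / 2 ^ m \<le> \<alpha>" "\<alpha> < real (j + 1) / 2 ^ m" using j by (simp_all add: field_simps)
    moreover have "real (j + 1) / 2 ^ m = real j / 2 ^ m + 1 / 2 ^ m" by (simp add: add_divide_distrib)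
    ultimately have "\<bar>\<theta> - \<alpha>\<bar> < 1 / 2 ^ m" using that by auto
    then show ?thesis using m by (simp add: dist_real_def)
  qed
  ultimately show ?thesis using d(2) that by blast
qed

text \<open>Each x with finite variation is the cotangent of an angle that visits neighbourhoods of
  \<open>g t\<close> or of \<open>g u\<close> too rarely. Such angles form a negligible set, and the
  differentiable cotangent maps it to a negligible set.\<close>

lemma AE_total_variation_means_infinite:
  fixes g :: "real \<Rightarrow> complex" and k :: "nat \<Rightarrow> nat"
  defines "R \<equiv> \<lambda>x N. (\<Sum>n=1..N. g ((boole_map ^^ k n) x)) / of_nat N"
  assumes g: "continuous_on UNIV g" "g t \<noteq> g u"
    and ud: "\<And>M. 1 < M \<Longrightarrow> uniformly_distributed_residues M k"
  shows "AE x in lebesgue. (\<Sum>N. ennreal (norm (R x (Suc (Suc N)) - R x (Suc N)))) = \<infinity>"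
proof -
  define \<delta> where "\<delta> = dist (g t) (g u) / 4"
  have \<delta>: "0 < \<delta>" "4 * \<delta> \<le> dist (g t) (g u)" using g(2) by (auto simp: \<delta>_def)
  \<comment> \<open>The open interval leaves out 0, where the cotangent is not
    differentiable.\<close>
  define S where "S w = {\<theta>\<in>{0<..<1}. summable (\<lambda>n.
    of_bool (dist (g ((boole_map ^^ k n) (cot (pi * \<theta>)))) w < \<delta>) / real n)}" for w
  have S: "negligible (S (g v))" for v
  proof -
    obtain j m where j: "j < 2 ^ m"
      "\<And>\<theta>. \<theta> \<in> {real j / 2 ^ m..<real (j + 1) / 2 ^ m} \<Longrightarrow> dist (g (cot (pi * \<theta>))) (g v) < \<delta>"
      using dyadic_interval_of_value[OF g(1) \<delta>(1), of v] by blast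
    show ?thesis
    proof (rule negligible_subset[OF doubling_map_visits[OF ud j(1)]], unfold S_def, safe)
      fix \<theta> :: real
      assume sm: "summable (\<lambda>n. of_bool (dist (g ((boole_map ^^ k n) (cot (pi * \<theta>)))) (g v) < \<delta>) / real n :: real)"
      show "summable (\<lambda>n. of_bool (frac (2 ^ k n * \<theta>) \<in> {real j / 2 ^ m..<real (j + 1) / 2 ^ m}) / real n :: real)"
      proof (rule summable_comparison_test'[OF sm, of 0])
        fix n
        show "norm (of_bool (frac (2 ^ k n * \<theta>) \<in> {real j / 2 ^ m..<real (j + 1) / 2 ^ m}) / real n :: real)
          \<le> of_bool (dist (g ((boole_map ^^ k n) (cot (pi * \<theta>)))) (g v) < \<delta>) / real n"
          unfolding boole_map_funpow_cot using j(2)[of "frac (2 ^ k n * \<theta>)"]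
          by (cases "frac (2 ^ k n * \<theta>) \<in> {real j / 2 ^ m..<real (j + 1) / 2 ^ m}") auto
      qed
    qed auto
  qed
  let ?B = "{x. (\<Sum>N. ennreal (norm (R x (Suc (Suc N)) - R x (Suc N)))) \<noteq> \<infinity>}"
  have "?B \<subseteq> (\<lambda>\<theta>. cot (pi * \<theta>)) ` (S (g t) \<union> S (g u))"
  proof
    fix x assume "x \<in> ?B"
    then have "summable (\<lambda>N. norm (R x (Suc (Suc N)) - R x (Suc N)))"
      by (intro summable_suminf_not_top) auto
    then obtain w where w: "w \<in> {g t, g u}"
      "summable (\<lambda>n. of_bool (dist (g ((boole_map ^^ k n) x)) w < \<delta>) / real n :: real)"
      using summable_visits_of_summable_mean_increments[OF _ \<delta>, of "\<lambda>n. g ((boole_map ^^ k n) x)"]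
      unfolding R_def by blast
    obtain \<theta> where "0 < \<theta>" "\<theta> < 1" "cot (pi * \<theta>) = x" by (rule cot_pi_surj)
    then show "x \<in> (\<lambda>\<theta>. cot (pi * \<theta>)) ` (S (g t) \<union> S (g u))"
      using w by (intro image_eqI[of _ _ \<theta>]) (auto simp: S_def)
  qed
  moreover have "negligible ((\<lambda>\<theta>. cot (pi * \<theta>)) ` (S (g t) \<union> S (g u)))"
  proof (rule negligible_differentiable_image_negligible)
    show "(\<lambda>\<theta>. cot (pi * \<theta>)) differentiable_on (S (g t) \<union> S (g u))"
      unfolding differentiable_on_def
    proof
      fix \<theta> assume "\<theta> \<in> S (g t) \<union> S (g u)"
      then have "sin (pi * \<theta>) \<noteq> 0" using sin_gt_zero[of "pi * \<theta>"] by (auto simp: S_def)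
      then have "((\<lambda>\<theta>. cot (pi * \<theta>)) has_real_derivative - inverse ((sin (pi * \<theta>))\<^sup>2) * pi) (at \<theta>)"
        by (intro DERIV_chain2[OF DERIV_cot] DERIV_cmult_Id)
      then show "(\<lambda>\<theta>. cot (pi * \<theta>)) differentiable at \<theta> within S (g t) \<union> S (g u)"
        by (meson differentiable_at_withinI real_differentiable_def)
    qed
  qed (use S in auto)
  ultimately have "negligible ?B" using negligible_subset by blast
  then have "?B \<in> null_sets lebesgue" by (simp add: negligible_iff_null_sets)
  then show ?thesis by (rule AE_I') auto
qed

theorem theorem1p5:
  fixes p \<sigma> :: real and k :: "nat \<Rightarrow> nat"
  assumes "p \<ge> 1" and "1 / 2 < \<sigma>" and "\<sigma> < 1"
    and "Hartman_uniformly_distributed k"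
    and "Lp_good_universal TYPE(real) p k"
  shows "AE x in lebesgue.
    (\<Sum>N. ennreal (norm (zeta_mean k \<sigma> x (Suc (Suc N)) - zeta_mean k \<sigma> x (Suc N)))) = \<infinity>"
proof -
  \<comment> \<open>The vertical line avoids the pole, so zeta is continuous along it and takes two
    distinct values there.\<close>
  have "\<sigma> \<noteq> 1" using assms(3) by simp
  then obtain t u where "zeta (Complex \<sigma> t) \<noteq> zeta (Complex \<sigma> u)"
    using zeta_vertical_line_nonconstant by blast
  moreover have "continuous_on UNIV (\<lambda>t. zeta (Complex \<sigma> t))"
    by (rule continuous_on_compose2[OF holomorphic_on_imp_continuous_on[OF zeta_holomorphic]])
       (use \<open>\<sigma> \<noteq> 1\<close> in \<open>auto intro!: continuous_intros simp: complex_eq_iff\<close>)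
  moreover have "uniformly_distributed_residues M k" if "1 < M" for M
    using assms(4) that by (simp add: Hartman_uniformly_distributed_def)
  ultimately show ?thesis
    unfolding zeta_mean_def by (intro AE_total_variation_means_infinite)
qed

end
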